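(* Let $(X,d)$ be a non-empty compact metric space and $f:X\to X$ a continuous map. For any integer $N>1$, the function $f^N$ is distributionally chaotic of type $2\frac12$ if and only if $f$ is distributionally chaotic of type $2\frac12$; that is, there is a pair of points of $X$ which is distributionally chaotic of type $2\frac12$ with respect to $f^N$ if and only if there is a pair of points of $X$ which is distributionally chaotic of type $2\frac12$ with respect to $f$.
   Context: Let $(X,d)$ be a non-empty compact metric space and $g:X\to X$ a continuous map. For $(x_1,x_2)\in X^2$ and $\delta>0$, the lower and upper distribution functions generated by $g$ are $$\Phi_{(x_1,x_2)}(\delta)=\liminf_{m\to\infty}\frac1m\#\{0\le k\le m:\ d(g^k(x_1),g^k(x_2))<\delta\},$$ $$\Phi^*_{(x_1,x_2)}(\delta)=\limsup_{m\to\infty}\frac1m\#\{0\le k\le m:\ d(g^k(x_1),g^k(x_2))<\delta\},$$ where $g^k$ is the $k$-th iterate of $g$ and $\#A$ is the cardinality of $A$. The pair $(x_1,x_2)$ is distributionally chaotic of type $2\frac12$ (DC$2\frac12$) with respect to $g$ if there exist numbers $c,q>0$ such that $\Phi_{(x_1,x_2)}(\delta)<c<\Phi^*_{(x_1,x_2)}(\delta)$ for every $0<\delta\le q$. Here a map $g$ is called distributionally chaotic of type $2\frac12$ if there exists a DC$2\frac12$ pair with respect to $g$. "With respect to $f^N$" means that the definitions of the distribution functions and of a DC$2\frac12$ pair are applied with $g=f^N$, so that the distances involved are $d(f^{Nk}(x_1),f^{Nk}(x_2))$. *)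

theory Defs
  imports "HOL-Analysis.Analysis"
begin

text \<open>
  The time \<open>k\<close> ranges over \<open>{0..m}\<close>, inclusive at both ends, while the count is divided by \<open>m\<close>.
  The quotient at \<open>m = 0\<close> is the junk value \<open>0\<close>; it does not affect limits inferior or superior.
\<close>

definition hit_frequency ::
    "('a \<Rightarrow> 'a \<Rightarrow> real) \<Rightarrow> ('a \<Rightarrow> 'a) \<Rightarrow> 'a \<Rightarrow> 'a \<Rightarrow> real \<Rightarrow> nat \<Rightarrow> real" where
  "hit_frequency d g x1 x2 \<delta> m =
     1 / real m * real (card {k. 0 \<le> k \<and> k \<le> m \<and> d ((g ^^ k) x1) ((g ^^ k) x2) < \<delta>})"

text \<open>
  The distribution functions are valued in \<open>ereal\<close>, because \<open>liminf\<close> and \<open>limsup\<close> require a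
  complete lattice. All their values lie between \<open>0\<close> and \<open>1\<close>.
\<close>

definition lower_distribution ::
    "('a \<Rightarrow> 'a \<Rightarrow> real) \<Rightarrow> ('a \<Rightarrow> 'a) \<Rightarrow> 'a \<Rightarrow> 'a \<Rightarrow> real \<Rightarrow> ereal" where
  "lower_distribution d g x1 x2 \<delta> = liminf (\<lambda>m. ereal (hit_frequency d g x1 x2 \<delta> m))"

definition upper_distribution ::
    "('a \<Rightarrow> 'a \<Rightarrow> real) \<Rightarrow> ('a \<Rightarrow> 'a) \<Rightarrow> 'a \<Rightarrow> 'a \<Rightarrow> real \<Rightarrow> ereal" where
  "upper_distribution d g x1 x2 \<delta> = limsup (\<lambda>m. ereal (hit_frequency d g x1 x2 \<delta> m))"

definition DC2half_pair ::
    "('a \<Rightarrow> 'a \<Rightarrow> real) \<Rightarrow> ('a \<Rightarrow> 'a) \<Rightarrow> 'a \<Rightarrow> 'a \<Rightarrow> bool" where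
  "DC2half_pair d g x1 x2 \<longleftrightarrow>
     (\<exists>c q :: real. c > 0 \<and> q > 0 \<and>
        (\<forall>\<delta>. 0 < \<delta> \<and> \<delta> \<le> q \<longrightarrow>
           lower_distribution d g x1 x2 \<delta> < ereal c \<and>
           ereal c < upper_distribution d g x1 x2 \<delta>))"

definition DC2half :: "'a set \<Rightarrow> ('a \<Rightarrow> 'a \<Rightarrow> real) \<Rightarrow> ('a \<Rightarrow> 'a) \<Rightarrow> bool" where
  "DC2half X d g \<longleftrightarrow> (\<exists>x1\<in>X. \<exists>x2\<in>X. DC2half_pair d g x1 x2)"

end

theory Submission
  imports Defs
begin

text \<open>
  Write \<open>\<Phi>\<close> and \<open>\<Psi>\<close> for the distribution functions of one pair with respect to \<open>f\<close> and \<open>f ^^ N\<close>,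
  lower or upper. By uniform continuity of \<open>f, \<dots>, f ^^ N\<close>, for every \<open>\<delta>\<close> there is \<open>\<eta>\<close>
  such that two points closer than \<open>\<eta>\<close> stay closer than \<open>\<delta>\<close> for the next \<open>N\<close> steps. Cut time into
  blocks of length \<open>N\<close>. A visit below \<open>\<eta>\<close> at the start of a block makes the whole block visits
  below \<open>\<delta>\<close>, so \<open>\<Psi> \<eta> \<le> \<Phi> \<delta>\<close>; a visit below \<open>\<eta>\<close> anywhere in a block makes the start of the next
  block a visit below \<open>\<delta>\<close>, so \<open>\<Phi> \<eta> \<le> \<Psi> \<delta>\<close>. Since \<open>\<Phi>\<close> and \<open>\<Psi>\<close> are monotone, a pair is
  DC2\<open>\<onehalf>\<close> for \<open>f\<close> iff the same pair is so for \<open>f ^^ N\<close>, with the same \<open>c\<close>.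
\<close>

subsection \<open>Limits inferior and superior along reindexed sequences\<close>

lemma Liminf_le_filterlim:
  fixes a :: "'b \<Rightarrow> 'c :: complete_linorder"
  assumes "filterlim g G F"
  shows "Liminf G a \<le> Liminf F (\<lambda>x. a (g x))"
  unfolding le_Liminf_iff using assms by (auto dest!: less_LiminfD simp: filterlim_iff)

lemma Limsup_ge_filterlim:
  fixes a :: "'b \<Rightarrow> 'c :: complete_linorder"
  assumes "filterlim g G F"
  shows "Limsup F (\<lambda>x. a (g x)) \<le> Limsup G a"
  unfolding Limsup_le_iff using assms by (auto dest!: Limsup_lessD simp: filterlim_iff)

lemma filterlim_mult_const_nat:
  fixes N :: nat
  assumes "N > 0"
  shows "filterlim ((*) N) sequentially sequentially"
  using assms by (intro filterlim_subseq) (simp add: strict_mono_def)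

text \<open>Both \<open>n div N\<close> and \<open>N * n\<close> tend to infinity with
  \<open>n\<close>, and \<open>(N * n) div N = n\<close>, so each sequence is a reindexing of the
  other.\<close>

lemma liminf_div_const:
  fixes a :: "nat \<Rightarrow> 'c :: complete_linorder"
  assumes "N > 0"
  shows "liminf (\<lambda>n. a (n div N)) = liminf a"
proof (rule antisym)
  show "liminf a \<le> liminf (\<lambda>n. a (n div N))"
    by (rule Liminf_le_filterlim[OF filterlim_at_top_div_const_nat[OF assms]])
  show "liminf (\<lambda>n. a (n div N)) \<le> liminf a"
    using Liminf_le_filterlim[OF filterlim_mult_const_nat[OF assms], of "\<lambda>n. a (n div N)"] assms
    by simp
qed

lemma limsup_div_const:
  fixes a :: "nat \<Rightarrow> 'c :: complete_linorder"
  assumes "N > 0"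
  shows "limsup (\<lambda>n. a (n div N)) = limsup a"
proof (rule antisym)
  show "limsup (\<lambda>n. a (n div N)) \<le> limsup a"
    by (rule Limsup_ge_filterlim[OF filterlim_at_top_div_const_nat[OF assms]])
  show "limsup a \<le> limsup (\<lambda>n. a (n div N))"
    using Limsup_ge_filterlim[OF filterlim_mult_const_nat[OF assms], of "\<lambda>n. a (n div N)"] assms
    by simp
qed

text \<open>Over \<open>ereal\<close>, a summand with a finite limit can be pulled out of
  \<open>liminf\<close> and \<open>limsup\<close>; here that limit is 0.\<close>

lemma Liminf_Limsup_le_vanishing_error:
  fixes a b e :: "nat \<Rightarrow> real"
  assumes le: "eventually (\<lambda>n. a n \<le> b n + e n) sequentially" and e: "e \<longlonglongrightarrow> 0"
  shows "liminf (\<lambda>n. ereal (a n)) \<le> liminf (\<lambda>n. ereal (b n))"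
    and "limsup (\<lambda>n. ereal (a n)) \<le> limsup (\<lambda>n. ereal (b n))"
proof -
  have e': "(\<lambda>n. ereal (e n)) \<longlonglongrightarrow> 0"
    using e by (simp add: zero_ereal_def)
  have le': "eventually (\<lambda>n. ereal (a n) \<le> ereal (e n) + ereal (b n)) sequentially"
    using le by (simp add: add.commute)
  show "liminf (\<lambda>n. ereal (a n)) \<le> liminf (\<lambda>n. ereal (b n))"
    using Liminf_mono[OF le'] ereal_liminf_lim_add[OF e', of "\<lambda>n. ereal (b n)"]
    by (simp del: plus_ereal.simps)
  show "limsup (\<lambda>n. ereal (a n)) \<le> limsup (\<lambda>n. ereal (b n))"
    using Limsup_mono[OF le'] ereal_limsup_lim_add[OF e', of "\<lambda>n. ereal (b n)"]
    by (simp del: plus_ereal.simps)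
qed

lemma tendsto_const_over_div:
  fixes N :: nat
  assumes "N > 0"
  shows "(\<lambda>n. C / real (n div N)) \<longlonglongrightarrow> 0"
  by (rule filterlim_compose[OF lim_const_over_n filterlim_at_top_div_const_nat[OF assms]])

subsection \<open>Counting in blocks\<close>

text \<open>An arbitrary predicate on times replaces the hit condition, so that the counting below
  is free of metrics and maps.\<close>

definition visit_frequency :: "(nat \<Rightarrow> bool) \<Rightarrow> nat \<Rightarrow> real" where
  "visit_frequency P m = real (card {k. k \<le> m \<and> P k}) / real m"

lemma hit_frequency_eq_visit_frequency:
  "hit_frequency d g x y \<delta> = visit_frequency (\<lambda>k. d ((g ^^ k) x) ((g ^^ k) y) < \<delta>)"
  by (simp add: fun_eq_iff hit_frequency_def visit_frequency_def)

lemma inj_on_block: "inj_on (\<lambda>(k, j). N * k + j) (A \<times> {..<N::nat})"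
proof (rule inj_onI, clarsimp)
  fix k j k' j' :: nat
  assume j: "j < N" "j' < N" and eq: "N * k + j = N * k' + j'"
  have "k = (N * k + j) div N" "k' = (N * k' + j') div N"
    using j by simp_all
  then show "k = k' \<and> j = j'"
    using eq by simp
qed

text \<open>Each \<open>k\<close> satisfying \<open>Q\<close> yields \<open>N\<close> visits of
  \<open>P\<close>, and distinct blocks are disjoint. The last block, starting at
  \<open>N * (n div N)\<close>, may run past \<open>n\<close>; the summand \<open>N\<close> pays for
  it.\<close>

lemma card_block_starts_le:
  fixes P Q :: "nat \<Rightarrow> bool"
  assumes PQ: "\<And>k j. Q k \<Longrightarrow> j < N \<Longrightarrow> P (N * k + j)"
  shows "N * card {k. k \<le> n div N \<and> Q k} \<le> card {l. l \<le> n \<and> P l} + N"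
proof -
  \<comment> \<open>The strict inequality keeps only the blocks that end before time
    \<open>n\<close>.\<close>
  define A where "A = {k. k < n div N \<and> Q k}"
  have fin: "finite A"
    unfolding A_def by simp
  have sub: "(\<lambda>(k, j). N * k + j) ` (A \<times> {..<N}) \<subseteq> {l. l \<le> n \<and> P l}"
  proof clarsimp
    fix k j assume k: "k \<in> A" and j: "j < N"
    have "N * k + j \<le> N * Suc k"
      using j by simp
    also have "\<dots> \<le> N * (n div N)"
      using k by (intro mult_le_mono2) (simp add: A_def)
    also have "\<dots> \<le> n"
      by simp
    finally show "N * k + j \<le> n \<and> P (N * k + j)"
      using PQ k j by (simp add: A_def)
  qed
  have "card A * N \<le> card {l. l \<le> n \<and> P l}"
    using card_mono[OF _ sub] by (simp add: card_image inj_on_block card_cartesian_product)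
  moreover have "card {k. k \<le> n div N \<and> Q k} \<le> Suc (card A)"
  proof -
    have "{k. k \<le> n div N \<and> Q k} \<subseteq> insert (n div N) A"
      unfolding A_def by auto
    then have "card {k. k \<le> n div N \<and> Q k} \<le> card (insert (n div N) A)"
      using fin by (intro card_mono) auto
    also have "\<dots> \<le> Suc (card A)"
      by (rule card_insert_le_m1) simp_all
    finally show ?thesis .
  qed
  then have "N * card {k. k \<le> n div N \<and> Q k} \<le> N * Suc (card A)"
    by (rule mult_le_mono2)
  ultimately show ?thesis
    by (simp add: mult.commute)
qed

text \<open>Every visit of \<open>P\<close> lies in a block whose successor starts with a visit of
  \<open>Q\<close>, and a block holds at most \<open>N\<close> visits. The successor index can be
  \<open>Suc (n div N)\<close>, just out of range, which accounts for the
  \<open>+ 1\<close>.\<close>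

lemma card_le_card_next_block_starts:
  fixes P Q :: "nat \<Rightarrow> bool"
  assumes N: "N > 0" and PQ: "\<And>k j. P (N * k + j) \<Longrightarrow> j < N \<Longrightarrow> Q (Suc k)"
  shows "card {l. l \<le> n \<and> P l} \<le> N * (card {k. k \<le> n div N \<and> Q k} + 1)"
proof -
  define A where "A = {k. k \<le> n div N \<and> Q (Suc k)}"
  have fin: "finite A"
    unfolding A_def by simp
  have "{l. l \<le> n \<and> P l} \<subseteq> (\<lambda>(k, j). N * k + j) ` (A \<times> {..<N})"
  proof
    fix l assume l: "l \<in> {l. l \<le> n \<and> P l}"
    have "P (N * (l div N) + l mod N)"
      using l by simp
    then have "Q (Suc (l div N))"
      using PQ N by (meson mod_less_divisor)
    then have "(l div N, l mod N) \<in> A \<times> {..<N}"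
      using l N by (auto simp: A_def div_le_mono)
    then show "l \<in> (\<lambda>(k, j). N * k + j) ` (A \<times> {..<N})"
      by (rule rev_image_eqI) simp
  qed
  then have "card {l. l \<le> n \<and> P l} \<le> card A * N"
    using fin by (metis card_cartesian_product card_lessThan finite_SigmaI finite_lessThan surj_card_le)
  moreover have "card A \<le> card {k. k \<le> n div N \<and> Q k} + 1"
  proof -
    have "card A = card (Suc ` A)"
      by (simp add: card_image)
    also have "\<dots> \<le> card (insert (Suc (n div N)) {k. k \<le> n div N \<and> Q k})"
      unfolding A_def by (intro card_mono) (auto simp: Suc_le_eq le_less)
    also have "\<dots> \<le> card {k. k \<le> n div N \<and> Q k} + 1"
      by simp
    finally show ?thesis .
  qed
  then have "N * card A \<le> N * (card {k. k \<le> n div N \<and> Q k} + 1)"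
    by (rule mult_le_mono2)
  ultimately show ?thesis
    by (simp add: mult.commute)
qed

lemma visit_frequency_block_starts_le:
  fixes P Q :: "nat \<Rightarrow> bool"
  assumes N: "N > 0" and PQ: "\<And>k j. Q k \<Longrightarrow> j < N \<Longrightarrow> P (N * k + j)" and n: "N \<le> n"
  shows "visit_frequency Q (n div N) \<le> visit_frequency P n + 3 / real (n div N)"
proof -
  define m where "m = n div N"
  define p where "p = real (card {l. l \<le> n \<and> P l})"
  define q where "q = real (card {k. k \<le> m \<and> Q k})"
  have m: "real m \<ge> 1"
    using N n by (simp add: m_def div_greater_zero_iff Suc_le_eq)
  have n1: "real n \<ge> 1" and N1: "real N \<ge> 1"
    using N n by simp_all
  have "real (N * card {k. k \<le> m \<and> Q k}) \<le> real (card {l. l \<le> n \<and> P l} + N)"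
    unfolding m_def of_nat_le_iff using PQ by (rule card_block_starts_le)
  then have "real N * q \<le> p + real N"
    by (simp add: p_def q_def)
  then have q: "q \<le> (p + N) / N"
    using N1 by (simp add: field_simps)
  have "n < N * m + N"
    using N by (simp add: m_def) (metis dividend_less_times_div mult_Suc_right add.commute)
  then have nm: "real n - N * m \<le> N"
    by (simp add: algebra_simps flip: of_nat_mult of_nat_add)
  \<comment> \<open>The times \<open>0, ..., n\<close> number \<open>n + 1\<close>, which is at most
    \<open>2 * n\<close> since \<open>n >= 1\<close>.\<close>
  have p: "0 \<le> p" "p \<le> 2 * n"
  proof -
    have "card {l. l \<le> n \<and> P l} \<le> card {..n}"
      by (intro card_mono) auto
    then show "p \<le> 2 * n"
      using n1 by (simp add: p_def)
  qed (simp add: p_def)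
  have "p * (real n - N * m) \<le> p * N"
    using nm p(1) by (rule mult_left_mono)
  also have "\<dots> \<le> real (2 * n) * real N"
    using p N1 by (intro mult_right_mono) simp_all
  \<comment> \<open>The constant 3 arises here: \<open>2 * n * N\<close> comes from replacing
    \<open>n\<close> by \<open>N * m\<close>, and \<open>N * n\<close> from the incomplete last
    block.\<close>
  finally have "(p + N) * n \<le> (p * m + 3 * n) * N"
    by (simp add: algebra_simps)
  then have "(p + N) / N \<le> (p * m + 3 * n) / n"
    using N1 n1 by (simp add: divide_simps)
  with q have "q \<le> (p * m + 3 * n) / n"
    by simp
  then have "q / m \<le> (p * m + 3 * n) / n / m"
    using m by (intro divide_right_mono) simp_all
  also have "\<dots> = p / n + 3 / m"
    using m n1 by (simp add: field_simps)
  finally show ?thesis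
    by (simp add: visit_frequency_def p_def q_def m_def)
qed

lemma visit_frequency_le_next_block_starts:
  fixes P Q :: "nat \<Rightarrow> bool"
  assumes N: "N > 0" and PQ: "\<And>k j. P (N * k + j) \<Longrightarrow> j < N \<Longrightarrow> Q (Suc k)" and n: "N \<le> n"
  shows "visit_frequency P n \<le> visit_frequency Q (n div N) + 1 / real (n div N)"
proof -
  define m where "m = n div N"
  define p where "p = real (card {l. l \<le> n \<and> P l})"
  define q where "q = real (card {k. k \<le> m \<and> Q k})"
  have m: "real m > 0"
    using N n by (simp add: m_def div_greater_zero_iff)
  have "card {l. l \<le> n \<and> P l} \<le> N * (card {k. k \<le> m \<and> Q k} + 1)"
    unfolding m_def using N PQ by (rule card_le_card_next_block_starts)
  then have "p \<le> real (N * (card {k. k \<le> m \<and> Q k} + 1))"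
    unfolding p_def by (rule of_nat_mono)
  then have "p \<le> N * (q + 1)"
    by (simp add: q_def algebra_simps)
  moreover have "real N * m \<le> n"
    unfolding m_def by (simp flip: of_nat_mult)
  ultimately have "p / n \<le> N * (q + 1) / (real N * m)"
    using N m by (intro frac_le) (simp_all add: q_def)
  also have "\<dots> = q / m + 1 / m"
    using N by (simp add: add_divide_distrib)
  finally show ?thesis
    by (simp add: visit_frequency_def p_def q_def m_def)
qed

text \<open>The frequencies are compared at time \<open>n\<close> for \<open>P\<close> and
  \<open>n div N\<close> for \<open>Q\<close>; the error vanishes, and reindexing removes the
  division.\<close>

lemma block_starts_limits_le:
  fixes P Q :: "nat \<Rightarrow> bool"
  assumes N: "N > 0" and PQ: "\<And>k j. Q k \<Longrightarrow> j < N \<Longrightarrow> P (N * k + j)"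
  shows "liminf (\<lambda>m. ereal (visit_frequency Q m)) \<le> liminf (\<lambda>m. ereal (visit_frequency P m))"
    and "limsup (\<lambda>m. ereal (visit_frequency Q m)) \<le> limsup (\<lambda>m. ereal (visit_frequency P m))"
proof -
  have "eventually (\<lambda>n. visit_frequency Q (n div N)
          \<le> visit_frequency P n + 3 / real (n div N)) sequentially"
    using eventually_ge_at_top[of N]
    by eventually_elim (rule visit_frequency_block_starts_le[OF N], erule (1) PQ)
  note le = Liminf_Limsup_le_vanishing_error[OF this tendsto_const_over_div[OF N]]
  show "liminf (\<lambda>m. ereal (visit_frequency Q m)) \<le> liminf (\<lambda>m. ereal (visit_frequency P m))"
    using le(1) by (simp add: liminf_div_const[OF N, of "\<lambda>m. ereal (visit_frequency Q m)"])
  show "limsup (\<lambda>m. ereal (visit_frequency Q m)) \<le> limsup (\<lambda>m. ereal (visit_frequency P m))"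
    using le(2) by (simp add: limsup_div_const[OF N, of "\<lambda>m. ereal (visit_frequency Q m)"])
qed

lemma next_block_starts_limits_ge:
  fixes P Q :: "nat \<Rightarrow> bool"
  assumes N: "N > 0" and PQ: "\<And>k j. P (N * k + j) \<Longrightarrow> j < N \<Longrightarrow> Q (Suc k)"
  shows "liminf (\<lambda>m. ereal (visit_frequency P m)) \<le> liminf (\<lambda>m. ereal (visit_frequency Q m))"
    and "limsup (\<lambda>m. ereal (visit_frequency P m)) \<le> limsup (\<lambda>m. ereal (visit_frequency Q m))"
proof -
  have "eventually (\<lambda>n. visit_frequency P n
          \<le> visit_frequency Q (n div N) + 1 / real (n div N)) sequentially"
    using eventually_ge_at_top[of N]
    by eventually_elim (rule visit_frequency_le_next_block_starts[OF N], erule (1) PQ)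
  note le = Liminf_Limsup_le_vanishing_error[OF this tendsto_const_over_div[OF N]]
  show "liminf (\<lambda>m. ereal (visit_frequency P m)) \<le> liminf (\<lambda>m. ereal (visit_frequency Q m))"
    using le(1) by (simp add: liminf_div_const[OF N, of "\<lambda>m. ereal (visit_frequency Q m)"])
  show "limsup (\<lambda>m. ereal (visit_frequency P m)) \<le> limsup (\<lambda>m. ereal (visit_frequency Q m))"
    using le(2) by (simp add: limsup_div_const[OF N, of "\<lambda>m. ereal (visit_frequency Q m)"])
qed

subsection \<open>Distribution functions of a map and of its iterate\<close>

text \<open>By compactness each iterate is uniformly continuous; the least of finitely many moduli
  works for all \<open>j <= N\<close>. The case \<open>j = N\<close> is needed to pass from one
  block start to the next.\<close>

lemma (in Metric_space) funpow_uniformly_equicontinuous: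
  assumes comp: "compact_space mtopology" and cont: "continuous_map mtopology mtopology f"
    and "\<delta> > 0"
  obtains \<eta> where "\<eta> > 0"
    and "\<And>x y j. x \<in> M \<Longrightarrow> y \<in> M \<Longrightarrow> d x y < \<eta> \<Longrightarrow> j \<le> N \<Longrightarrow> d ((f ^^ j) x) ((f ^^ j) y) < \<delta>"
proof -
  have "\<exists>\<eta>>0. \<forall>x\<in>M. \<forall>y\<in>M. d x y < \<eta> \<longrightarrow> d ((f ^^ j) x) ((f ^^ j) y) < \<delta>" for j
  proof -
    have "continuous_map mtopology mtopology (f ^^ j)"
      by (induction j) (simp_all add: continuous_map_compose[OF _ cont] del: o_apply)
    then have "uniformly_continuous_map (metric (M, d)) (metric (M, d)) (f ^^ j)"
      using comp by (intro continuous_imp_uniformly_continuous_map) auto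
    then show ?thesis
      using \<open>\<delta> > 0\<close> unfolding uniformly_continuous_map_def by simp metis
  qed
  then obtain \<eta> where \<eta>: "\<And>j. \<eta> j > 0"
      "\<And>j x y. x \<in> M \<Longrightarrow> y \<in> M \<Longrightarrow> d x y < \<eta> j \<Longrightarrow> d ((f ^^ j) x) ((f ^^ j) y) < \<delta>"
    by metis
  show thesis
  proof
    show "Min (\<eta> ` {..N}) > 0"
      using \<eta>(1) by simp
    show "d ((f ^^ j) x) ((f ^^ j) y) < \<delta>"
      if "x \<in> M" "y \<in> M" "d x y < Min (\<eta> ` {..N})" "j \<le> N" for x y j
      using that by (intro \<eta>(2)) auto
  qed
qed

lemma (in Metric_space) distribution_funpow_compare:
  assumes comp: "compact_space mtopology" and cont: "continuous_map mtopology mtopology f"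
    and N: "N > 0" and x: "x \<in> M" and y: "y \<in> M" and "\<delta> > 0"
  obtains \<eta> where "\<eta> > 0"
    and "lower_distribution d (f ^^ N) x y \<eta> \<le> lower_distribution d f x y \<delta>"
    and "upper_distribution d (f ^^ N) x y \<eta> \<le> upper_distribution d f x y \<delta>"
    and "lower_distribution d f x y \<eta> \<le> lower_distribution d (f ^^ N) x y \<delta>"
    and "upper_distribution d f x y \<eta> \<le> upper_distribution d (f ^^ N) x y \<delta>"
proof -
  obtain \<eta> where \<eta>: "\<eta> > 0"
    and close: "\<And>x y j. x \<in> M \<Longrightarrow> y \<in> M \<Longrightarrow> d x y < \<eta> \<Longrightarrow> j \<le> N \<Longrightarrow> d ((f ^^ j) x) ((f ^^ j) y) < \<delta>"
    using funpow_uniformly_equicontinuous[OF comp cont \<open>\<delta> > 0\<close>] by metis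
  have orbit: "(f ^^ k) z \<in> M" if "z \<in> M" for k z
    using that cont by (induction k) (auto simp: continuous_map_def Pi_iff)
  have step: "d ((f ^^ (j + k)) x) ((f ^^ (j + k)) y) < \<delta>"
    if "d ((f ^^ k) x) ((f ^^ k) y) < \<eta>" "j \<le> N" for j k
    using close[OF orbit[OF x] orbit[OF y] that] by (simp add: funpow_add)
  have start: "d ((f ^^ (N * k + j)) x) ((f ^^ (N * k + j)) y) < \<delta>"
    if "d (((f ^^ N) ^^ k) x) (((f ^^ N) ^^ k) y) < \<eta>" "j < N" for k j
    using step[of "N * k" j] that by (simp add: funpow_mult add.commute mult.commute)
  have nxt: "d (((f ^^ N) ^^ Suc k) x) (((f ^^ N) ^^ Suc k) y) < \<delta>"
    if "d ((f ^^ (N * k + j)) x) ((f ^^ (N * k + j)) y) < \<eta>" "j < N" for k j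
  proof -
    \<comment> \<open>Waiting \<open>N - j\<close> steps leads from position \<open>j\<close> of
      block \<open>k\<close> to the start of block \<open>Suc k\<close>.\<close>
    have "N - j + (N * k + j) = N * Suc k"
      using that by simp
    then have "d ((f ^^ (N * Suc k)) x) ((f ^^ (N * Suc k)) y) < \<delta>"
      using step[OF that(1), of "N - j"] by simp
    then show ?thesis
      by (simp only: funpow_mult mult.commute)
  qed
  show thesis
    \<comment> \<open>Both rules unify with all four goals; backtracking pairs the first two goals
      with \<open>start\<close> and the last two with \<open>nxt\<close>.\<close>
    by (rule that[OF \<eta>];
        unfold lower_distribution_def upper_distribution_def hit_frequency_eq_visit_frequency;
        rule block_starts_limits_le[OF N] next_block_starts_limits_ge[OF N];
        erule (1) start nxt)
qed

lemma distribution_mono: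
  assumes "\<delta> \<le> \<delta>'"
  shows "lower_distribution d g x y \<delta> \<le> lower_distribution d g x y \<delta>'"
    and "upper_distribution d g x y \<delta> \<le> upper_distribution d g x y \<delta>'"
proof -
  have "hit_frequency d g x y \<delta> m \<le> hit_frequency d g x y \<delta>' m" for m
    unfolding hit_frequency_eq_visit_frequency visit_frequency_def
    using assms by (intro divide_right_mono of_nat_mono card_mono) auto
  then show "lower_distribution d g x y \<delta> \<le> lower_distribution d g x y \<delta>'"
    and "upper_distribution d g x y \<delta> \<le> upper_distribution d g x y \<delta>'"
    unfolding lower_distribution_def upper_distribution_def
    by (auto intro!: Liminf_mono Limsup_mono)
qed

text \<open>The constant \<open>c\<close> is kept. For the lower function the single value
  \<open>q\<close> suffices: it gives a new threshold \<open>r\<close>, and monotonicity covers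
  everything below. The upper bound is obtained at every positive \<delta>.\<close>

lemma DC2half_pair_transfer:
  assumes pair: "DC2half_pair d g x y"
    and lower: "\<And>\<delta>. \<delta> > 0 \<Longrightarrow> \<exists>\<eta>>0. lower_distribution d h x y \<eta> \<le> lower_distribution d g x y \<delta>"
    and upper: "\<And>\<delta>. \<delta> > 0 \<Longrightarrow> \<exists>\<eta>>0. upper_distribution d g x y \<eta> \<le> upper_distribution d h x y \<delta>"
  shows "DC2half_pair d h x y"
proof -
  obtain c q where c: "c > 0" and q: "q > 0"
    and g: "\<And>\<delta>. 0 < \<delta> \<Longrightarrow> \<delta> \<le> q \<Longrightarrow> lower_distribution d g x y \<delta> < ereal c"
           "\<And>\<delta>. 0 < \<delta> \<Longrightarrow> \<delta> \<le> q \<Longrightarrow> ereal c < upper_distribution d g x y \<delta>"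
    using pair unfolding DC2half_pair_def by blast
  obtain r where r: "r > 0" "lower_distribution d h x y r \<le> lower_distribution d g x y q"
    using lower[OF q] by blast
  have "lower_distribution d h x y \<delta> < ereal c" if "\<delta> \<le> r" for \<delta>
    using distribution_mono(1)[OF that] r(2) g(1)[OF q order.refl] by (meson order.strict_trans1)
  moreover have "ereal c < upper_distribution d h x y \<delta>" if "0 < \<delta>" for \<delta>
  proof -
    obtain \<eta> where \<eta>: "\<eta> > 0" "upper_distribution d g x y \<eta> \<le> upper_distribution d h x y \<delta>"
      using upper[OF \<open>0 < \<delta>\<close>] by blast
    \<comment> \<open>\<eta> may exceed \<open>q\<close>, beyond which nothing is known for
      \<open>g\<close>; the minimum stays in range.\<close>
    have "ereal c < upper_distribution d g x y (min \<eta> q)"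
      using \<eta>(1) q by (intro g(2)) simp_all
    also have "\<dots> \<le> upper_distribution d g x y \<eta>"
      by (rule distribution_mono(2)) simp
    finally show ?thesis
      using \<eta>(2) by (rule order.strict_trans2)
  qed
  ultimately show ?thesis
    unfolding DC2half_pair_def using c r(1) by blast
qed

theorem theorem2:
  fixes X :: "'a set" and d :: "'a \<Rightarrow> 'a \<Rightarrow> real" and f :: "'a \<Rightarrow> 'a" and N :: nat
  assumes "Metric_space X d"
    and "X \<noteq> {}"
    and "compact_space (Metric_space.mtopology X d)"
    and "continuous_map (Metric_space.mtopology X d) (Metric_space.mtopology X d) f"
    and "N > 1"
  shows "DC2half X d (f ^^ N) \<longleftrightarrow> DC2half X d f"
proof -
  have "N > 0"
    using assms(5) by simp
  note compare = Metric_space.distribution_funpow_compare[OF assms(1,3,4) this]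
  have "DC2half_pair d (f ^^ N) x y \<longleftrightarrow> DC2half_pair d f x y" if "x \<in> X" "y \<in> X" for x y
    \<comment> \<open>Passing from \<open>f ^^ N\<close> to \<open>f\<close> uses the second and
      third inequalities of \<open>compare\<close>, the converse the first and fourth.\<close>
    by (rule iffI; erule DC2half_pair_transfer; metis compare that)
  then show ?thesis
    unfolding DC2half_def by blast
qed

end
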